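(* Let $\mathbb{F}$ be a field and $d\ge0$ an integer. Let $\Psi=(\mathcal{C};\{x_i\}_{i=0}^d;\{e_i\}_{i=0}^d)$ be a character system over $\mathbb{F}$ with diameter $d$. Then the eigenmatrix $P$ of $\Psi$ is normalized solid invertible.
   Context: All algebras are associative, unital, over $\mathbb{F}$. Matrices in $\mathrm{Mat}_{d+1}(\mathbb{F})$ have rows and columns indexed by $0,1,\ldots,d$. A character algebra over $\mathbb{F}$ with diameter $d$ is a sequence $(\mathcal{C};\{x_i\}_{i=0}^d)$ where $\mathcal{C}$ is a commutative $\mathbb{F}$-algebra and $x_i\in\mathcal{C}$ satisfy: (i) $x_0=1$; (ii) $\{x_i\}_{i=0}^d$ is a basis of $\mathcal{C}$; (iii) writing $x_ix_j=\sum_{h=0}^d p^h_{ij}x_h$, there are nonzero scalars $\{k_i\}_{i=0}^d$ with $p^0_{ij}=\delta_{i,j}k_i$ for $0\le i,j\le d$; (iv) there is an algebra homomorphism $\varphi:\mathcal{C}\to\mathbb{F}$ with $\varphi(x_i)=k_i$ for $0\le i\le d$. It is semisimple if $\mathcal{C}$ has a basis $\{e_i\}_{i=0}^d$ with $e_ie_j=\delta_{i,j}e_i$ and $1=\sum_{i=0}^d e_i$; these $e_i$ (unique up to permutation) are the primitive idempotents. Exactly one primitive idempotent is not sent to $0$ by $\varphi$; it is called trivial. A character system over $\mathbb{F}$ with diameter $d$ is a sequence $\Psi=(\mathcal{C};\{x_i\}_{i=0}^d;\{e_i\}_{i=0}^d)$ where $(\mathcal{C};\{x_i\}_{i=0}^d)$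 is a semisimple character algebra over $\mathbb{F}$ and $\{e_i\}_{i=0}^d$ is an ordering of the primitive idempotents with $e_0$ trivial. The eigenmatrix $P$ of $\Psi$ is the transition matrix from $\{e_i\}$ to $\{x_i\}$: $x_j=\sum_{i=0}^dP_{i,j}e_i$ for $0\le j\le d$. An invertible $R\in\mathrm{Mat}_{d+1}(\mathbb{F})$ is solid if for both $R$ and $R^{-1}$ all entries in column $0$ and in row $0$ are nonzero. A solid invertible $R$ is normalized if all entries in column $0$ of $R$ are equal to $1$ and all entries in column $0$ of $R^{-1}$ are the same. *)

theory Defs
  imports "Jordan_Normal_Form.Matrix"
begin

text \<open>Commutative algebras over a field: the scalar action is an explicit parameter, so that the
  ground field and the algebra are both arbitrary.\<close>

locale comm_algebra = vector_space scale
  for scale :: "'f::field \<Rightarrow> 'c::comm_ring_1 \<Rightarrow> 'c" (infixr "*s" 75) +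
  assumes scale_mult_left: "(a *s u) * v = a *s (u * v)"
begin

definition is_basis :: "nat \<Rightarrow> (nat \<Rightarrow> 'c) \<Rightarrow> bool" where
  "is_basis d b \<longleftrightarrow> inj_on b {..d} \<and> independent (b ` {..d}) \<and> span (b ` {..d}) = UNIV"

definition coord :: "nat \<Rightarrow> (nat \<Rightarrow> 'c) \<Rightarrow> 'c \<Rightarrow> nat \<Rightarrow> 'f" where
  "coord d b v i = representation (b ` {..d}) v (b i)"

lemma sum_coord:
  assumes "is_basis d b"
  shows "v = (\<Sum>i\<le>d. coord d b v i *s b i)"
proof -
  have "v = (\<Sum>w\<in>b ` {..d}. representation (b ` {..d}) v w *s w)"
    using assms by (intro sum_representation_eq[symmetric]) (auto simp: is_basis_def)
  also have "\<dots> = (\<Sum>i\<le>d. coord d b v i *s b i)"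
    using assms by (simp add: is_basis_def sum.reindex coord_def)
  finally show ?thesis .
qed

definition algebra_hom_to_field :: "('c \<Rightarrow> 'f) \<Rightarrow> bool" where
  "algebra_hom_to_field \<phi> \<longleftrightarrow>
     Vector_Spaces.linear scale (*) \<phi> \<and> \<phi> 1 = 1 \<and> (\<forall>u v. \<phi> (u * v) = \<phi> u * \<phi> v)"

text \<open>\<open>struct_const d x h i j\<close> is the scalar $p^h_{ij}$.\<close>

definition struct_const :: "nat \<Rightarrow> (nat \<Rightarrow> 'c) \<Rightarrow> nat \<Rightarrow> nat \<Rightarrow> nat \<Rightarrow> 'f" where
  "struct_const d x h i j = coord d x (x i * x j) h"

text \<open>The condition $p^0_{ij} = \delta_{i,j} k_i$ forces $k_i = p^0_{ii}$.\<close>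

definition valency :: "nat \<Rightarrow> (nat \<Rightarrow> 'c) \<Rightarrow> nat \<Rightarrow> 'f" where
  "valency d x i = struct_const d x 0 i i"

definition valency_hom :: "nat \<Rightarrow> (nat \<Rightarrow> 'c) \<Rightarrow> ('c \<Rightarrow> 'f) \<Rightarrow> bool" where
  "valency_hom d x \<phi> \<longleftrightarrow> algebra_hom_to_field \<phi> \<and> (\<forall>i\<le>d. \<phi> (x i) = valency d x i)"

definition primitive_idempotents :: "nat \<Rightarrow> (nat \<Rightarrow> 'c) \<Rightarrow> bool" where
  "primitive_idempotents d e \<longleftrightarrow>
     is_basis d e \<and> (\<forall>i\<le>d. \<forall>j\<le>d. e i * e j = (if i = j then e i else 0)) \<and> 1 = (\<Sum>i\<le>d. e i)"

end

text \<open>Throughout, the values of the families \<open>x\<close> and \<open>e\<close> at indices beyond \<open>d\<close> are irrelevant.\<close>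

locale character_algebra = comm_algebra scale
  for scale :: "'f::field \<Rightarrow> 'c::comm_ring_1 \<Rightarrow> 'c" (infixr "*s" 75) +
  fixes d :: nat and x :: "nat \<Rightarrow> 'c"
  assumes x_0: "x 0 = 1"
    and basis_x: "is_basis d x"
    and valency_nonzero: "i \<le> d \<Longrightarrow> valency d x i \<noteq> 0"
    and struct_const_0: "i \<le> d \<Longrightarrow> j \<le> d \<Longrightarrow>
      struct_const d x 0 i j = (if i = j then valency d x i else 0)"
    and ex_valency_hom: "\<exists>\<phi>. valency_hom d x \<phi>"
begin

text \<open>A homomorphism as in \<open>ex_valency_hom\<close> is unique, since its values on a basis are
  prescribed; hence the existential quantifier here refers to the homomorphism $\varphi$.\<close>

definition trivial_idempotent :: "'c \<Rightarrow> bool" where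
  "trivial_idempotent u \<longleftrightarrow> (\<exists>\<phi>. valency_hom d x \<phi> \<and> \<phi> u \<noteq> 0)"

lemma valency_hom_unique:
  assumes "valency_hom d x \<phi>" "valency_hom d x \<psi>"
  shows "\<phi> = \<psi>"
proof
  fix v
  have *: "\<chi> v = (\<Sum>i\<le>d. coord d x v i * valency d x i)" if "valency_hom d x \<chi>" for \<chi>
  proof -
    have "Vector_Spaces.linear scale (*) \<chi>"
      using that by (simp add: valency_hom_def algebra_hom_to_field_def)
    then interpret Vector_Spaces.linear scale "(*)" \<chi> .
    have "\<chi> v = \<chi> (\<Sum>i\<le>d. coord d x v i *s x i)"
      using sum_coord[OF basis_x] by simp
    also have "\<dots> = (\<Sum>i\<le>d. coord d x v i * valency d x i)"
      using that by (simp add: sum scale valency_hom_def)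
    finally show ?thesis .
  qed
  show "\<phi> v = \<psi> v"
    using *[OF assms(1)] *[OF assms(2)] by simp
qed

end

text \<open>Semisimplicity of the underlying character algebra is witnessed by \<open>e\<close> itself.\<close>

locale character_system = character_algebra scale d x
  for scale :: "'f::field \<Rightarrow> 'c::comm_ring_1 \<Rightarrow> 'c" (infixr "*s" 75)
    and d :: nat and x :: "nat \<Rightarrow> 'c" +
  fixes e :: "nat \<Rightarrow> 'c"
  assumes primitive_idempotents_e: "primitive_idempotents d e"
    and trivial_e_0: "trivial_idempotent (e 0)"
begin

definition eigenmatrix :: "'f mat" where
  "eigenmatrix = mat (d + 1) (d + 1) (\<lambda>(i, j). coord d e (x j) i)"

lemma eigenmatrix_transition:
  assumes "j \<le> d"
  shows "x j = (\<Sum>i\<le>d. eigenmatrix $$ (i, j) *s e i)"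
proof -
  have "x j = (\<Sum>i\<le>d. coord d e (x j) i *s e i)"
    using primitive_idempotents_e by (intro sum_coord) (simp add: primitive_idempotents_def)
  then show ?thesis
    using assms by (simp add: eigenmatrix_def)
qed

end

definition mat_inv :: "'f::field mat \<Rightarrow> 'f mat" where
  "mat_inv R = inv\<^bsub>ring_mat TYPE('f) (dim_row R) ()\<^esub> R"

definition solid_invertible :: "nat \<Rightarrow> 'f::field mat \<Rightarrow> bool" where
  "solid_invertible d R \<longleftrightarrow>
     R \<in> carrier_mat (d + 1) (d + 1) \<and> invertible_mat R \<and>
     (\<forall>S \<in> {R, mat_inv R}. \<forall>i\<le>d. S $$ (i, 0) \<noteq> 0 \<and> S $$ (0, i) \<noteq> 0)"

definition normalized_solid_invertible :: "nat \<Rightarrow> 'f::field mat \<Rightarrow> bool" where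
  "normalized_solid_invertible d R \<longleftrightarrow>
     solid_invertible d R \<and> (\<forall>i\<le>d. R $$ (i, 0) = 1) \<and>
     (\<forall>i\<le>d. \<forall>j\<le>d. mat_inv R $$ (i, 0) = mat_inv R $$ (j, 0))"

lemma mat_inv_eqI:
  fixes R :: "'f::field mat"
  assumes "R \<in> carrier_mat n n" "S \<in> carrier_mat n n" "R * S = 1\<^sub>m n" "S * R = 1\<^sub>m n"
  shows "mat_inv R = S"
proof -
  interpret ring "ring_mat TYPE('f) n ()"
    by (rule ring_mat)
  have "inv\<^bsub>ring_mat TYPE('f) n ()\<^esub> R = S"
    using assms by (intro inv_unique'[symmetric]) (auto simp: ring_mat_simps)
  then show ?thesis
    using assms(1) by (simp add: mat_inv_def)
qed

end

theory Submission
  imports Defs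
begin

text \<open>Let $t(v)$ be the coefficient of $x_0$ in $v$. The form $(u, v) \mapsto t(uv)$ satisfies
  $t(x_i x_j) = \delta_{i,j} k_i$, so the coefficient of $x_j$ in $v$ is $t(v x_j) / k_j$. The inverse
  $Q$ of $P$ expresses the $e_i$ in terms of the $x_j$. Since $e_i x_j = P_{i,j} e_i$, this gives
  $k_j Q_{j,i} = P_{i,j} Q_{0,i}$; in particular $Q_{0,i} = 0$ would force $e_i = 0$. Applying
  $\varphi$ to $e_0 x_j = P_{0,j} e_0$, where $\varphi(e_0) \neq 0$, gives $P_{0,j} = k_j$, hence
  $Q_{j,0} = Q_{0,0}$.\<close>

context comm_algebra
begin

lemma is_basis_coord_linear:
  assumes "is_basis d b"
  shows "Vector_Spaces.linear scale (*) (\<lambda>v. coord d b v i)"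
proof -
  interpret field: vector_space "(*) :: 'f \<Rightarrow> 'f \<Rightarrow> 'f"
    by unfold_locales (auto simp: algebra_simps)
  show ?thesis
    using assms
    by unfold_locales
      (auto simp: is_basis_def coord_def representation_add representation_scale)
qed

lemma coord_sum:
  assumes "is_basis d b"
  shows "coord d b (\<Sum>j\<in>A. c j *s u j) i = (\<Sum>j\<in>A. c j * coord d b (u j) i)"
proof -
  interpret Vector_Spaces.linear scale "(*)" "\<lambda>v. coord d b v i"
    by (rule is_basis_coord_linear[OF assms])
  show ?thesis
    by (simp add: sum scale)
qed

lemma coord_scale:
  assumes "is_basis d b"
  shows "coord d b (c *s v) i = c * coord d b v i"
  using coord_sum[OF assms, where A = "{()}"] by simp

lemma coord_basis:
  assumes "is_basis d b" "i \<le> d" "j \<le> d"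
  shows "coord d b (b j) i = (if i = j then 1 else 0)"
  using assms
  by (auto simp: is_basis_def coord_def representation_basis inj_on_def)

lemma basis_nonzero:
  assumes "is_basis d b" "i \<le> d"
  shows "b i \<noteq> 0"
proof
  assume "b i = 0"
  then have "0 \<in> b ` {..d}"
    using assms(2) by (metis atMost_iff imageI)
  then show False
    using assms(1) dependent_zero by (auto simp: is_basis_def)
qed

lemma coord_eq_coord_sum:
  assumes "is_basis d b" "is_basis d c"
  shows "coord d c v i = (\<Sum>j\<le>d. coord d b v j * coord d c (b j) i)"
  using coord_sum[OF assms(2), where u = b and c = "coord d b v" and A = "{..d}"]
    sum_coord[OF assms(1), of v]
  by simp

text \<open>Column \<open>j\<close> holds the coordinates of \<open>c j\<close> with respect to
  \<open>b\<close>. Both P and its inverse are of this form, with \<open>b\<close> and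
  \<open>c\<close> exchanged.\<close>

definition transition_mat :: "nat \<Rightarrow> (nat \<Rightarrow> 'c) \<Rightarrow> (nat \<Rightarrow> 'c) \<Rightarrow> 'f mat" where
  "transition_mat d b c = mat (d + 1) (d + 1) (\<lambda>(i, j). coord d b (c j) i)"

lemma transition_mat_mult:
  assumes "is_basis d b" "is_basis d c"
  shows "transition_mat d b c * transition_mat d c b = 1\<^sub>m (d + 1)"
proof (rule eq_matI)
  fix i j
  assume "i < dim_row (1\<^sub>m (d + 1) :: 'f mat)" "j < dim_col (1\<^sub>m (d + 1) :: 'f mat)"
  then have ij: "i \<le> d" "j \<le> d"
    by auto
  have "(transition_mat d b c * transition_mat d c b) $$ (i, j) =
      (\<Sum>k\<le>d. coord d b (c k) i * coord d c (b j) k)"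
    using ij
    by (simp add: transition_mat_def scalar_prod_def atLeast0LessThan lessThan_Suc_atMost
        del: sum.lessThan_Suc)
  \<comment> \<open>Expand \<open>b j\<close> in the basis \<open>c\<close>, then take the
    \<open>i\<close>-th \<open>b\<close>-coordinate of each term.\<close>
  also have "\<dots> = coord d b (b j) i"
    by (simp add: coord_eq_coord_sum[OF assms(2,1), of "b j"] mult.commute)
  also have "\<dots> = 1\<^sub>m (d + 1) $$ (i, j)"
    using ij by (simp add: coord_basis[OF assms(1)])
  finally show "(transition_mat d b c * transition_mat d c b) $$ (i, j) = 1\<^sub>m (d + 1) $$ (i, j)" .
qed (auto simp: transition_mat_def)

lemma
  assumes "is_basis d b" "is_basis d c"
  shows mat_inv_transition_mat: "mat_inv (transition_mat d b c) = transition_mat d c b"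
    and invertible_transition_mat: "invertible_mat (transition_mat d b c)"
proof -
  show "mat_inv (transition_mat d b c) = transition_mat d c b"
    using transition_mat_mult[OF assms] transition_mat_mult[OF assms(2,1)]
    by (intro mat_inv_eqI[where n = "d + 1"]) (auto simp: transition_mat_def)
  have "square_mat (transition_mat d b c)"
    "inverts_mat (transition_mat d b c) (transition_mat d c b)"
    "inverts_mat (transition_mat d c b) (transition_mat d b c)"
    using transition_mat_mult[OF assms] transition_mat_mult[OF assms(2,1)]
    by (simp_all add: inverts_mat_def transition_mat_def)
  then show "invertible_mat (transition_mat d b c)"
    unfolding invertible_mat_def by blast
qed

text \<open>Orthogonality kills every term of the expansion of \<open>v\<close> except the
  \<open>i\<close>-th. So \<open>e i\<close> is an eigenvector of multiplication by any
  \<open>v\<close>; for \<open>v = x j\<close> the eigenvalue is the entry (i, j) of P.\<close>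

lemma primitive_idempotent_mult:
  assumes "primitive_idempotents d e" "i \<le> d"
  shows "e i * v = coord d e v i *s e i"
proof -
  have "e i * v = (\<Sum>j\<le>d. coord d e v j *s e j) * e i"
    using assms sum_coord[of d e v] by (simp add: primitive_idempotents_def mult.commute)
  also have "\<dots> = (\<Sum>j\<le>d. coord d e v j *s (e j * e i))"
    by (simp add: sum_distrib_right scale_mult_left)
  also have "\<dots> = (\<Sum>j\<le>d. if j = i then coord d e v i *s e i else 0)"
    using assms by (intro sum.cong) (auto simp: primitive_idempotents_def)
  also have "\<dots> = coord d e v i *s e i"
    using assms(2) by simp
  finally show ?thesis .
qed

text \<open>Multiplication by 1 has eigenvalue 1 on the nonzero vector \<open>e i\<close>. Since
  \<open>x 0 = 1\<close>, this determines column 0 of P.\<close>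

lemma coord_primitive_idempotents_one:
  assumes "primitive_idempotents d e" "i \<le> d"
  shows "coord d e 1 i = 1"
proof -
  have e: "is_basis d e"
    using assms(1) by (simp add: primitive_idempotents_def)
  have "coord d e 1 i *s e i = 1 *s e i"
    using primitive_idempotent_mult[OF assms, of 1] by simp
  then show ?thesis
    using basis_nonzero[OF e assms(2)] by (metis scale_right_imp_eq)
qed

end

context character_algebra
begin

text \<open>The bilinear form t(uv) is diagonal on the basis \<open>x\<close>, so pairing with
  \<open>x j\<close> isolates the \<open>j\<close>-th coordinate, scaled by the valency.\<close>

lemma coord_0_mult:
  assumes "j \<le> d"
  shows "coord d x (v * x j) 0 = coord d x v j * valency d x j"
proof -
  have "v * x j = (\<Sum>i\<le>d. coord d x v i *s (x i * x j))"
    using arg_cong[OF sum_coord[OF basis_x, of v], of "\<lambda>u. u * x j"]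
    by (simp add: sum_distrib_right scale_mult_left)
  then have "coord d x (v * x j) 0 = (\<Sum>i\<le>d. coord d x v i * struct_const d x 0 i j)"
    by (simp add: coord_sum[OF basis_x] struct_const_def)
  also have "\<dots> = (\<Sum>i\<le>d. if i = j then coord d x v j * valency d x j else 0)"
    using assms by (intro sum.cong) (auto simp: struct_const_0)
  also have "\<dots> = coord d x v j * valency d x j"
    using assms by simp
  finally show ?thesis .
qed

end

context character_system
begin

lemma basis_e: "is_basis d e"
  using primitive_idempotents_e by (simp add: primitive_idempotents_def)

text \<open>Row 0 of P consists of valencies, hence of nonzero scalars. Triviality of
  \<open>e 0\<close> is what allows \<phi>(\<open>e 0\<close>) to be cancelled.\<close>

lemma coord_e_0: "coord d e (x j) 0 = valency d x j" if "j \<le> d"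
proof -
  obtain \<phi> where \<phi>: "valency_hom d x \<phi>" "\<phi> (e 0) \<noteq> 0"
    using trivial_e_0 by (auto simp: trivial_idempotent_def)
  then have "Vector_Spaces.linear scale (*) \<phi>"
    by (simp add: valency_hom_def algebra_hom_to_field_def)
  then interpret Vector_Spaces.linear scale "(*)" \<phi> .
  have "\<phi> (e 0) * \<phi> (x j) = coord d e (x j) 0 * \<phi> (e 0)"
    using \<phi>(1) arg_cong[OF primitive_idempotent_mult[OF primitive_idempotents_e, of 0 "x j"], of \<phi>]
    by (simp add: valency_hom_def algebra_hom_to_field_def scale)
  then show ?thesis
    using \<phi> that by (simp add: valency_hom_def)
qed

text \<open>Both sides are the coefficient of \<open>x 0\<close> in \<open>e i * x j\<close>: the
  left by the diagonal form, the right because \<open>e i\<close> is an eigenvector.\<close>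

lemma coord_x_valency:
  assumes "i \<le> d" "j \<le> d"
  shows "coord d x (e i) j * valency d x j = coord d e (x j) i * coord d x (e i) 0"
  using coord_0_mult[OF assms(2), of "e i"]
  by (simp add: primitive_idempotent_mult[OF primitive_idempotents_e assms(1)]
      coord_scale[OF basis_x])

lemma coord_x_0_nonzero:
  assumes "i \<le> d"
  shows "coord d x (e i) 0 \<noteq> 0"
proof
  assume "coord d x (e i) 0 = 0"
  then have "coord d x (e i) j = 0" if "j \<le> d" for j
    using coord_x_valency[OF assms that] valency_nonzero[OF that] by simp
  then have "e i = 0"
    using sum_coord[OF basis_x, of "e i"] by simp
  then show False
    using basis_nonzero[OF basis_e assms] by simp
qed

text \<open>For \<open>i = 0\<close> both sides of \<open>coord_x_valency\<close> carry the nonzero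
  factor \<open>valency d x j\<close>, which cancels.\<close>

lemma coord_x_e_0: "coord d x (e 0) j = coord d x (e 0) 0" if "j \<le> d"
  using coord_x_valency[OF _ that, of 0] coord_e_0[OF that] valency_nonzero[OF that] by simp

lemma eigenmatrix_eq_transition_mat: "eigenmatrix = transition_mat d e x"
  by (simp add: eigenmatrix_def transition_mat_def)

lemma normalized_solid_invertible_eigenmatrix: "normalized_solid_invertible d eigenmatrix"
proof -
  have P: "eigenmatrix $$ (i, j) = coord d e (x j) i" if "i \<le> d" "j \<le> d" for i j
    using that by (simp add: eigenmatrix_def)
  have Q: "mat_inv eigenmatrix $$ (i, j) = coord d x (e j) i" if "i \<le> d" "j \<le> d" for i j
    using that
    by (simp add: eigenmatrix_eq_transition_mat mat_inv_transition_mat[OF basis_e basis_x])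
      (simp add: transition_mat_def)
  have col: "coord d x (e 0) i \<noteq> 0" if "i \<le> d" for i
    using coord_x_e_0[OF that] coord_x_0_nonzero[of 0] by simp
  have "S $$ (i, 0) \<noteq> 0 \<and> S $$ (0, i) \<noteq> 0"
    if "S \<in> {eigenmatrix, mat_inv eigenmatrix}" "i \<le> d" for S i
    \<comment> \<open>Four cases: column 0 of P is all ones and its row 0 holds the valencies; row 0
      of the inverse is nonzero by \<open>coord_x_0_nonzero\<close>, and its column 0 by
      \<open>col\<close>.\<close>
    using that
    by (auto simp: P Q x_0 col coord_primitive_idempotents_one[OF primitive_idempotents_e]
        coord_e_0 valency_nonzero coord_x_0_nonzero)
  moreover have "eigenmatrix \<in> carrier_mat (d + 1) (d + 1)"
    by (simp add: eigenmatrix_def)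
  moreover have "invertible_mat eigenmatrix"
    unfolding eigenmatrix_eq_transition_mat by (rule invertible_transition_mat[OF basis_e basis_x])
  moreover have "eigenmatrix $$ (i, 0) = 1" if "i \<le> d" for i
    using that by (simp add: P x_0 coord_primitive_idempotents_one[OF primitive_idempotents_e])
  moreover have "mat_inv eigenmatrix $$ (i, 0) = mat_inv eigenmatrix $$ (j, 0)"
    if "i \<le> d" "j \<le> d" for i j
    using that coord_x_e_0[of i] coord_x_e_0[of j] by (simp add: Q)
  ultimately show ?thesis
    unfolding normalized_solid_invertible_def solid_invertible_def by blast
qed

end

theorem proposition10p11:
  fixes scale :: "'f::field \<Rightarrow> 'c::comm_ring_1 \<Rightarrow> 'c"
    and d :: nat
    and x e :: "nat \<Rightarrow> 'c"
  assumes "character_system scale d x e"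
  shows "normalized_solid_invertible d (character_system.eigenmatrix scale d x e)"
  using assms by (rule character_system.normalized_solid_invertible_eigenmatrix)

end
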